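(* If $H$ and $H'$ are $\chi$-unavoidable ordered graphs and $r_<^m(H,H')\ge 1$, then $(H,H')$ is Ramsey infinite.
   Context: An ordered graph is a finite simple graph together with a linear order of its vertex set. A copy of an ordered graph $H$ in $F$ is a subgraph of $F$ (with inherited order) isomorphic to $H$ via an order-preserving bijection. $R_<(H,H')$ is the set of ordered graphs $F$ such that every red/blue coloring of the edges of $F$ contains a red copy of $H$ or a blue copy of $H'$; $F\in R_<(H,H')$ is minimal if no proper subgraph of $F$ lies in $R_<(H,H')$; $(H,H')$ is Ramsey finite if $R_<(H,H')$ has only finitely many minimal elements (up to order-preserving isomorphism), and Ramsey infinite otherwise. The density of a graph $G$ is $m(G)=\max\{|E(G')|/|V(G')| : G'\subseteq G\}$ and $r_<^m(H,H')=\inf\{m(F): F\in R_<(H,H')\}$. An ordered graph $H$ is $\chi$-unavoidable if there is an integer $k$ such that every ordered graph of chromatic number at least $k$ contains a copy of $H$. *)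

theory Defs
  imports Complex_Main
begin

text \<open>
  The linear order of the vertex set is the one inherited from the ambient linearly ordered
  type. Every finite linear order embeds into \<^typ>\<open>nat\<close>, so up to order-preserving isomorphism
  every ordered graph is a \<^typ>\<open>nat\<close>-graph; quantification over all host graphs
  is therefore quantification over graphs on vertices in \<^typ>\<open>nat\<close>.
\<close>

datatype 'a ograph = OGraph (verts: "'a set") (edges: "'a set set")

definition ordered_graph :: "'a::linorder ograph \<Rightarrow> bool" where
  "ordered_graph G \<longleftrightarrow>
     finite (verts G) \<and> (\<forall>e\<in>edges G. \<exists>u\<in>verts G. \<exists>v\<in>verts G. u \<noteq> v \<and> e = {u, v})"

definition subgraph :: "'a::linorder ograph \<Rightarrow> 'a ograph \<Rightarrow> bool" where
  "subgraph G F \<longleftrightarrow> ordered_graph G \<and> verts G \<subseteq> verts F \<and> edges G \<subseteq> edges F"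

definition order_iso :: "'a::linorder ograph \<Rightarrow> 'b::linorder ograph \<Rightarrow> bool" where
  "order_iso G H \<longleftrightarrow>
     (\<exists>f. bij_betw f (verts G) (verts H) \<and> strict_mono_on (verts G) f \<and>
          edges H = (\<lambda>e. f ` e) ` edges G)"

definition is_copy :: "'a::linorder ograph \<Rightarrow> 'b::linorder ograph \<Rightarrow> 'a ograph \<Rightarrow> bool" where
  "is_copy G H F \<longleftrightarrow> subgraph G F \<and> order_iso G H"

datatype colour = Red | Blue

text \<open>Colourings are total functions; only their values on the edges of \<open>F\<close> matter.\<close>

definition ramsey_set :: "'a::linorder ograph \<Rightarrow> 'b::linorder ograph \<Rightarrow> nat ograph set" where
  "ramsey_set H H' = {F. ordered_graph F \<and>
     (\<forall>c :: nat set \<Rightarrow> colour.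
        (\<exists>G. is_copy G H F \<and> (\<forall>e\<in>edges G. c e = Red)) \<or>
        (\<exists>G. is_copy G H' F \<and> (\<forall>e\<in>edges G. c e = Blue)))}"

definition minimal_ramsey_set ::
    "'a::linorder ograph \<Rightarrow> 'b::linorder ograph \<Rightarrow> nat ograph set" where
  "minimal_ramsey_set H H' =
     {F \<in> ramsey_set H H'. \<forall>G. subgraph G F \<and> G \<noteq> F \<longrightarrow> G \<notin> ramsey_set H H'}"

definition ramsey_finite :: "'a::linorder ograph \<Rightarrow> 'b::linorder ograph \<Rightarrow> bool" where
  "ramsey_finite H H' \<longleftrightarrow>
     finite (minimal_ramsey_set H H' //
       {(F, G). F \<in> minimal_ramsey_set H H' \<and> G \<in> minimal_ramsey_set H H' \<and> order_iso F G})"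

definition ramsey_infinite :: "'a::linorder ograph \<Rightarrow> 'b::linorder ograph \<Rightarrow> bool" where
  "ramsey_infinite H H' \<longleftrightarrow> \<not> ramsey_finite H H'"

text \<open>
  The graph without vertices is a subgraph of every graph; since \<open>0 / 0 = 0\<close> it contributes the
  value 0, which does not change the maximum.
\<close>

definition density :: "'a::linorder ograph \<Rightarrow> real" where
  "density F = Max {real (card (edges G)) / real (card (verts G)) | G. subgraph G F}"

definition ramsey_density :: "'a::linorder ograph \<Rightarrow> 'b::linorder ograph \<Rightarrow> real" where
  "ramsey_density H H' = Inf (density ` ramsey_set H H')"

definition proper_colouring :: "'a::linorder ograph \<Rightarrow> nat \<Rightarrow> ('a \<Rightarrow> nat) \<Rightarrow> bool" where
  "proper_colouring G k c \<longleftrightarrow>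
     (\<forall>v\<in>verts G. c v < k) \<and>
     (\<forall>u\<in>verts G. \<forall>v\<in>verts G. {u, v} \<in> edges G \<longrightarrow> c u \<noteq> c v)"

definition chromatic_number :: "'a::linorder ograph \<Rightarrow> nat" where
  "chromatic_number G = (LEAST k. \<exists>c. proper_colouring G k c)"

definition chi_unavoidable :: "'a::linorder ograph \<Rightarrow> bool" where
  "chi_unavoidable H \<longleftrightarrow>
     (\<exists>k. \<forall>F :: nat ograph. ordered_graph F \<and> k \<le> chromatic_number F \<longrightarrow>
        (\<exists>G. is_copy G H F))"

end

theory Submission
  imports Defs
begin

text \<open>
  If every ordered graph of chromatic number at least \<open>k\<close> (\<open>k'\<close>) contains \<open>H\<close> (\<open>H'\<close>), then every
  graph \<open>F\<close> without a proper colouring in \<open>k k'\<close> colours lies in \<open>R\<^sub><(H, H')\<close>: if the red and the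
  blue part had smaller chromatic numbers, the product of their colourings would properly colour
  \<open>F\<close>. By the deletion method of Erdos, \<open>F\<close> can be chosen such that all its subgraphs on at most
  \<open>g\<close> vertices have fewer edges than vertices. Every member of \<open>R\<^sub><(H, H')\<close> has density at least 1,
  so a minimal one inside \<open>F\<close> has more than \<open>g\<close> vertices; as \<open>g\<close> is arbitrary, there are
  infinitely many minimal ones.
\<close>

section \<open>Sparse graphs of large chromatic number\<close>

text \<open>For \<open>E \<subseteq> P\<close>, the probability that exactly the elements of
  \<open>E\<close> are kept when each element of \<open>P\<close> is kept independently with
  probability \<open>p\<close>. Expectations become finite sums over \<open>Pow P\<close>.\<close>

definition bernoulli_weight :: "real \<Rightarrow> 'e set \<Rightarrow> 'e set \<Rightarrow> real" where
  "bernoulli_weight p P E = p ^ card E * (1 - p) ^ card (P - E)"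

lemma bernoulli_weight_nonneg: "0 \<le> p \<Longrightarrow> p \<le> 1 \<Longrightarrow> 0 \<le> bernoulli_weight p P E"
  by (simp add: bernoulli_weight_def)

text \<open>The probability that the random set contains \<open>S\<close>. In the product of the
  sums \<open>p + q x\<close>, with \<open>q x = 0\<close> on \<open>S\<close> and
  \<open>q x = 1 - p\<close> elsewhere, expansion over subsets \<open>E\<close> leaves precisely the
  terms with \<open>S \<subseteq> E\<close>.\<close>

lemma sum_bernoulli_weight_supset:
  assumes "finite P" "S \<subseteq> P"
  shows "(\<Sum>E\<in>Pow P. bernoulli_weight p P E * of_bool (S \<subseteq> E)) = p ^ card S"
proof -
  have "(\<Prod>x\<in>P. p + (if x \<in> S then 0 else 1 - p)) =
      (\<Sum>E\<in>Pow P. (\<Prod>x\<in>E. p) * (\<Prod>x\<in>P - E. if x \<in> S then 0 else 1 - p))"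
    by (rule prod_add[OF assms(1)])
  also have "\<dots> = (\<Sum>E\<in>Pow P. bernoulli_weight p P E * of_bool (S \<subseteq> E))"
  proof (rule sum.cong[OF refl])
    fix E assume "E \<in> Pow P"
    have "(\<Prod>x\<in>P - E. if x \<in> S then 0 else 1 - p) = (1 - p) ^ card (P - E) * of_bool (S \<subseteq> E)"
    proof (cases "S \<subseteq> E")
      case True
      then have "(\<Prod>x\<in>P - E. if x \<in> S then 0 else 1 - p) = (\<Prod>x\<in>P - E. 1 - p)"
        by (intro prod.cong) auto
      then show ?thesis using True by simp
    next
      case False
      then obtain x where "x \<in> P - E" "x \<in> S" using assms by blast
      then have "(\<Prod>x\<in>P - E. if x \<in> S then 0 else 1 - p) = 0"
        using assms(1) by (intro prod_zero) auto
      then show ?thesis using False by simp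
    qed
    then show "(\<Prod>x\<in>E. p) * (\<Prod>x\<in>P - E. if x \<in> S then 0 else 1 - p) =
        bernoulli_weight p P E * of_bool (S \<subseteq> E)"
      by (simp add: bernoulli_weight_def)
  qed
  also have "(\<Prod>x\<in>P. p + (if x \<in> S then 0 else 1 - p)) = (\<Prod>x\<in>P. if x \<in> S then p else 1)"
    by (intro prod.cong) auto
  also have "\<dots> = p ^ card S"
    using assms by (simp add: prod.If_cases Int_absorb1)
  finally show ?thesis by simp
qed

text \<open>Taking complements in \<open>P\<close> exchanges \<open>p\<close> with
  \<open>1 - p\<close> and turns avoiding \<open>S\<close> into containing \<open>S\<close>.\<close>

lemma sum_bernoulli_weight_disjoint:
  assumes "finite P" "S \<subseteq> P"
  shows "(\<Sum>E\<in>Pow P. bernoulli_weight p P E * of_bool (S \<inter> E = {})) = (1 - p) ^ card S"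
proof -
  have compl: "P - (P - E) = E" if "E \<subseteq> P" for E using that by blast
  have "(\<Sum>E\<in>Pow P. bernoulli_weight p P E * of_bool (S \<inter> E = {})) =
      (\<Sum>E\<in>Pow P. bernoulli_weight (1 - p) P E * of_bool (S \<subseteq> E))"
    by (rule sum.reindex_bij_witness[of _ "\<lambda>E. P - E" "\<lambda>E. P - E"])
      (use assms in \<open>auto simp: bernoulli_weight_def compl\<close>)
  then show ?thesis using sum_bernoulli_weight_supset[OF assms, of "1 - p"] by simp
qed

text \<open>Let \<open>X\<close> count the sets \<open>S i\<close> missed by \<open>E\<close> plus
  \<open>a\<close> times the sets \<open>T j\<close> inside \<open>E\<close>. Its mean is below 1,
  so some \<open>E\<close> has \<open>X E < 1\<close>. A single missed \<open>S i\<close> would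
  already contribute 1, so none is missed.\<close>

lemma first_moment:
  assumes "finite P" "0 \<le> p" "p \<le> 1" "finite I" "finite J"
    and S: "\<And>i. i \<in> I \<Longrightarrow> S i \<subseteq> P" and T: "\<And>j. j \<in> J \<Longrightarrow> T j \<subseteq> P" and "0 \<le> a"
    and less: "(\<Sum>i\<in>I. (1 - p) ^ card (S i)) + a * (\<Sum>j\<in>J. p ^ card (T j)) < 1"
  obtains E where "E \<subseteq> P" "\<And>i. i \<in> I \<Longrightarrow> S i \<inter> E \<noteq> {}" "a * real (card {j\<in>J. T j \<subseteq> E}) < 1"
proof -
  define X where
    "X E = (\<Sum>i\<in>I. of_bool (S i \<inter> E = {})) + a * (\<Sum>j\<in>J. of_bool (T j \<subseteq> E))" for E
  let ?w = "bernoulli_weight p P"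
  have "(\<Sum>E\<in>Pow P. ?w E * X E) =
      (\<Sum>i\<in>I. \<Sum>E\<in>Pow P. ?w E * of_bool (S i \<inter> E = {})) +
      a * (\<Sum>j\<in>J. \<Sum>E\<in>Pow P. ?w E * of_bool (T j \<subseteq> E))"
    unfolding X_def distrib_left sum.distrib sum_distrib_left
    by (subst (1 2) sum.swap[of _ "Pow P"]) (simp add: mult_ac)
  also have "\<dots> < 1"
  proof -
    have "(\<Sum>i\<in>I. \<Sum>E\<in>Pow P. ?w E * of_bool (S i \<inter> E = {})) = (\<Sum>i\<in>I. (1 - p) ^ card (S i))"
      by (intro sum.cong refl sum_bernoulli_weight_disjoint assms(1) S)
    moreover have "(\<Sum>j\<in>J. \<Sum>E\<in>Pow P. ?w E * of_bool (T j \<subseteq> E)) = (\<Sum>j\<in>J. p ^ card (T j))"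
      by (intro sum.cong refl sum_bernoulli_weight_supset assms(1) T)
    ultimately show ?thesis using less by (simp only:)
  qed
  finally have mean: "(\<Sum>E\<in>Pow P. ?w E * X E) < 1" .
  have total: "(\<Sum>E\<in>Pow P. ?w E) = 1"
    using sum_bernoulli_weight_supset[OF assms(1), of "{}" p] by simp
  have "\<exists>E\<in>Pow P. X E < 1"
  proof (rule ccontr)
    assume "\<not> (\<exists>E\<in>Pow P. X E < 1)"
    then have "(\<Sum>E\<in>Pow P. ?w E * 1) \<le> (\<Sum>E\<in>Pow P. ?w E * X E)"
      using assms(2,3) by (intro sum_mono mult_left_mono) (auto simp: bernoulli_weight_nonneg not_less)
    then show False using mean total by simp
  qed
  then obtain E where E: "E \<subseteq> P" "X E < 1" by blast
  have pos: "0 \<le> a * (\<Sum>j\<in>J. of_bool (T j \<subseteq> E))" "0 \<le> (\<Sum>i\<in>I. of_bool (S i \<inter> E = {}) :: real)"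
    using \<open>0 \<le> a\<close> by (auto intro!: mult_nonneg_nonneg sum_nonneg)
  show thesis
  proof
    show "E \<subseteq> P" by (rule E)
    show "S i \<inter> E \<noteq> {}" if "i \<in> I" for i
    proof
      assume "S i \<inter> E = {}"
      then have "1 \<le> (\<Sum>i\<in>I. of_bool (S i \<inter> E = {}) :: real)"
        using member_le_sum[OF that, of "\<lambda>i. of_bool (S i \<inter> E = {}) :: real"] \<open>finite I\<close> by simp
      then show False using E(2) pos(1) by (simp add: X_def)
    qed
    have "(\<Sum>j\<in>J. of_bool (T j \<subseteq> E) :: real) = real (card {j\<in>J. T j \<subseteq> E})"
      using \<open>finite J\<close> by (simp add: Int_def)
    then show "a * real (card {j\<in>J. T j \<subseteq> E}) < 1" using E(2) pos(2) by (simp add: X_def)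
  qed
qed

section \<open>Small vertex sets spanning many edges\<close>

definition pairs :: "'v set \<Rightarrow> 'v set set" where
  "pairs V = {e. e \<subseteq> V \<and> card e = 2}"

lemma finite_pairs: "finite V \<Longrightarrow> finite (pairs V)"
  by (simp add: pairs_def)

lemma pairs_mono: "S \<subseteq> V \<Longrightarrow> pairs S \<subseteq> pairs V"
  by (auto simp: pairs_def)

lemma card_pairs: "finite V \<Longrightarrow> card (pairs V) = card V choose 2"
  by (simp add: pairs_def n_subsets)

text \<open>A witness that a vertex set \<open>S\<close> of size at most \<open>g\<close> spans at
  least \<open>card S\<close> edges. Fixing \<open>card T = card S\<close> makes its probability
  \<open>p ^ card S\<close>; excluding the empty set leaves a vertex to delete.\<close>

definition dense_spots :: "nat \<Rightarrow> 'v set \<Rightarrow> ('v set \<times> 'v set set) set" where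
  "dense_spots g V =
     {(S, T). S \<subseteq> V \<and> S \<noteq> {} \<and> card S \<le> g \<and> T \<subseteq> pairs S \<and> card T = card S}"

lemma dense_spots_subset: "dense_spots g V \<subseteq> Pow V \<times> Pow (pairs V)"
proof
  fix j assume "j \<in> dense_spots g V"
  then have "fst j \<subseteq> V" "snd j \<subseteq> pairs (fst j)" by (auto simp: dense_spots_def)
  then have "fst j \<subseteq> V" "snd j \<subseteq> pairs V" using pairs_mono[of "fst j" V] by auto
  then show "j \<in> Pow V \<times> Pow (pairs V)" by (simp add: mem_Times_iff)
qed

lemma finite_dense_spots: "finite V \<Longrightarrow> finite (dense_spots g V)"
  by (rule finite_subset[OF dense_spots_subset]) (simp add: finite_pairs)

text \<open>Bounds the expected number of dense spots independently of \<open>card V\<close> as long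
  as \<open>p * card V\<close> stays bounded. Each \<open>S\<close> admits at most
  \<open>2 ^ 2 ^ g\<close> sets \<open>T\<close>; dropping the size bound on \<open>S\<close>
  completes the sum of \<open>p ^ card S\<close> to \<open>(1 + p) ^ card V\<close>.\<close>

lemma sum_dense_spots_le:
  assumes "finite V" "0 \<le> (p::real)"
  shows "(\<Sum>j\<in>dense_spots g V. p ^ card (snd j)) \<le> 2 ^ 2 ^ g * exp (p * card V)"
proof -
  let ?S = "{S. S \<subseteq> V \<and> card S \<le> g}"
  have fin: "finite S" if "S \<subseteq> V" for S using that assms(1) finite_subset by blast
  have "(\<Sum>j\<in>dense_spots g V. p ^ card (snd j)) \<le> (\<Sum>j\<in>Sigma ?S (\<lambda>S. Pow (pairs S)). p ^ card (fst j))"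
  proof -
    have "(\<Sum>j\<in>dense_spots g V. p ^ card (snd j)) = (\<Sum>j\<in>dense_spots g V. p ^ card (fst j))"
      by (intro sum.cong) (auto simp: dense_spots_def)
    also have "\<dots> \<le> (\<Sum>j\<in>Sigma ?S (\<lambda>S. Pow (pairs S)). p ^ card (fst j))"
      using assms fin by (intro sum_mono2 finite_SigmaI) (auto simp: dense_spots_def finite_pairs)
    finally show ?thesis .
  qed
  also have "\<dots> = (\<Sum>S\<in>?S. \<Sum>T\<in>Pow (pairs S). p ^ card S)"
    using assms fin by (subst sum.Sigma) (auto simp: finite_pairs case_prod_beta)
  also have "\<dots> \<le> (\<Sum>S\<in>?S. 2 ^ 2 ^ g * p ^ card S)"
  proof (rule sum_mono)
    fix S assume S: "S \<in> ?S"
    have "card (pairs S) \<le> card (Pow S)"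
      using S fin by (intro card_mono) (auto simp: pairs_def)
    also have "\<dots> \<le> 2 ^ g" using S fin by (auto simp: card_Pow)
    finally have "(2::real) ^ card (pairs S) \<le> 2 ^ 2 ^ g" by (intro power_increasing) auto
    then show "(\<Sum>T\<in>Pow (pairs S). p ^ card S) \<le> 2 ^ 2 ^ g * p ^ card S"
      using S fin assms(2) by (auto simp: card_Pow finite_pairs intro!: mult_right_mono)
  qed
  also have "\<dots> \<le> (\<Sum>S\<in>Pow V. 2 ^ 2 ^ g * p ^ card S)"
    using assms by (intro sum_mono2) auto
  also have "\<dots> = 2 ^ 2 ^ g * (1 + p) ^ card V"
    using prod_add[OF assms(1), of "\<lambda>_. p" "\<lambda>_. 1"] by (simp add: sum_distrib_left add.commute)
  also have "\<dots> \<le> 2 ^ 2 ^ g * exp p ^ card V"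
    using assms(2) by (intro mult_left_mono power_mono) auto
  also have "exp p ^ card V = exp (p * card V)"
    by (simp add: exp_of_nat2_mult)
  finally show ?thesis .
qed

text \<open>Bounds the probability that a given set of \<open>s\<close> vertices is independent, by
  \<open>1 - p \<le> exp (- p)\<close> and \<open>s - 1 \<ge> s / 2\<close>.\<close>

lemma one_minus_power_choose_two_le:
  assumes "2 \<le> s" "0 \<le> p" "p \<le> (1::real)"
  shows "(1 - p) ^ (s choose 2) \<le> exp (- p * real s ^ 2 / 4)"
proof -
  have "real (s choose 2) = real s * (real s - 1) / 2"
    using assms(1) by (simp add: choose_two real_of_nat_div of_nat_diff)
  moreover have "real s * (real s / 2) \<le> real s * (real s - 1)"
    using assms(1) by (intro mult_left_mono) auto
  ultimately have choose: "real s ^ 2 / 4 \<le> real (s choose 2)"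
    by (simp add: power2_eq_square)
  have "(1 - p) ^ (s choose 2) \<le> exp (- p) ^ (s choose 2)"
    using assms(2,3) exp_ge_add_one_self[of "- p"] by (intro power_mono) auto
  also have "\<dots> = exp (- p * real (s choose 2))"
    by (simp only: exp_of_nat2_mult)
  also have "\<dots> \<le> exp (- p * real s ^ 2 / 4)"
    using mult_left_mono[OF choose assms(2)] by simp
  finally show ?thesis .
qed

text \<open>The random step of the deletion method. Fewer than \<open>K * s\<close> dense spots
  means that deleting one vertex from each leaves more than half of the \<open>2 * K * s\<close>
  vertices.\<close>

lemma sparse_edge_set_exists:
  assumes K: "0 < K"
  obtains s :: nat and E :: "nat set set"
  where "E \<subseteq> pairs {..<2 * K * s}"
    "\<And>S. S \<subseteq> {..<2 * K * s} \<Longrightarrow> card S = s \<Longrightarrow> pairs S \<inter> E \<noteq> {}"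
    "card {j \<in> dense_spots g {..<2 * K * s}. snd j \<subseteq> E} < K * s"
proof -
  define C :: real where "C = 2 ^ 2 ^ g * exp (32 * real K ^ 2)"
  obtain m :: nat where m: "2 * C < real m" using reals_Archimedean2 by blast
  \<comment> \<open>The summand \<open>m\<close> gives \<open>2 * C < s\<close>, while
    \<open>16 * K\<close> ensures that the \<open>p\<close> chosen below is at most 1.\<close>
  define s where "s = m + 16 * K"
  have s: "16 * K \<le> s" "2 * C < real s" "2 \<le> s" using m K by (auto simp: s_def)
  define V where "V = {..<2 * K * s}"
  have V: "finite V" "card V = 2 * K * s" by (auto simp: V_def)
  \<comment> \<open>The expected degree is about \<open>p \<cdot> 2 K s = 32 K\<^sup>2\<close>: this is independent of \<open>s\<close>, so the expected
    number of dense spots stays below \<open>C\<close>, and large enough to beat the at most \<open>2\<^sup>n\<close> candidates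
    for an independent set, \<open>n = 2 K s\<close>.\<close>
  define p where "p = 16 * real K / real s"
  have p: "0 \<le> p" "p \<le> 1"
    using s(1,3) by (simp_all add: p_def divide_simps)
  let ?I = "{S. S \<subseteq> V \<and> card S = s}"
  have "(\<Sum>S\<in>?I. (1 - p) ^ card (pairs S)) \<le> (\<Sum>S\<in>?I. exp (- 2 * real (card V)))"
  proof (rule sum_mono)
    fix S assume S: "S \<in> ?I"
    have "(1 - p) ^ card (pairs S) \<le> exp (- p * real s ^ 2 / 4)"
      using S finite_subset[OF _ V(1)] one_minus_power_choose_two_le[OF s(3) p] by (auto simp: card_pairs)
    also have "- p * real s ^ 2 / 4 = - 2 * real (card V)"
      using s(3) by (simp add: p_def V power2_eq_square)
    finally show "(1 - p) ^ card (pairs S) \<le> exp (- 2 * real (card V))" .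
  qed
  also have "\<dots> \<le> (\<Sum>S\<in>Pow V. exp (- 2 * real (card V)))"
    using V by (intro sum_mono2) auto
  also have "\<dots> = 2 ^ card V * exp (- 2 * real (card V))"
    using V(1) by (simp add: card_Pow)
  \<comment> \<open>With \<open>n = card V\<close>, half of the exponent \<open>- 2 * n\<close>
    absorbs the \<open>2 ^ n\<close> candidates; the remaining \<open>exp (- n)\<close> is at most
    1/2.\<close>
  also have "\<dots> \<le> exp 1 ^ card V * exp (- 2 * real (card V))"
    using exp_ge_add_one_self[of 1] by (intro mult_right_mono power_mono) auto
  also have "\<dots> = inverse (exp (real (card V)))"
    by (simp add: exp_of_nat_mult[symmetric] exp_minus[symmetric] exp_add[symmetric])
  also have "\<dots> \<le> inverse 2"
  proof (rule le_imp_inverse_le)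
    have "1 \<le> K * s" using K s(3) by simp
    then have "1 \<le> real K * real s" by (metis of_nat_1 of_nat_le_iff of_nat_mult)
    then show "2 \<le> exp (real (card V))"
      using exp_ge_add_one_self[of "real (card V)"] by (simp only: V of_nat_mult of_nat_numeral)
  qed simp
  finally have indep: "(\<Sum>S\<in>?I. (1 - p) ^ card (pairs S)) \<le> 1 / 2" by simp
  have "(\<Sum>j\<in>dense_spots g V. p ^ card (snd j)) \<le> 2 ^ 2 ^ g * exp (p * card V)"
    by (rule sum_dense_spots_le[OF V(1) p(1)])
  also have "\<dots> = C"
    using s(3) by (simp add: C_def V p_def power2_eq_square)
  also have "\<dots> < real s / 2" using s(2) by simp
  also have "\<dots> \<le> real (K * s) / 2" using K by (intro divide_right_mono of_nat_mono) auto
  \<comment> \<open>The factor \<open>1 / (K * s)\<close> scales the desired bound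
    \<open>K * s\<close> on the number of spots to the threshold 1 of
    \<open>first_moment\<close>.\<close>
  finally have dense: "1 / real (K * s) * (\<Sum>j\<in>dense_spots g V. p ^ card (snd j)) < 1 / 2"
    using K s(3) by (simp add: field_simps)
  obtain E where E: "E \<subseteq> pairs V" "\<And>S. S \<in> ?I \<Longrightarrow> pairs S \<inter> E \<noteq> {}"
    "1 / real (K * s) * real (card {j \<in> dense_spots g V. snd j \<subseteq> E}) < 1"
  proof (rule first_moment[where P = "pairs V" and p = p and I = ?I and J = "dense_spots g V"
        and S = pairs and T = snd and a = "1 / real (K * s)"])
    show "(\<Sum>S\<in>?I. (1 - p) ^ card (pairs S)) +
        1 / real (K * s) * (\<Sum>j\<in>dense_spots g V. p ^ card (snd j)) < 1"
      using indep dense by linarith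
    show "snd j \<subseteq> pairs V" if "j \<in> dense_spots g V" for j
      using subsetD[OF dense_spots_subset that] by (simp add: mem_Times_iff)
    show "pairs S \<subseteq> pairs V" if "S \<in> ?I" for S
      using that pairs_mono[of S V] by simp
  qed (use V p in \<open>auto simp: finite_pairs finite_dense_spots\<close>)
  have "real (card {j \<in> dense_spots g V. snd j \<subseteq> E}) < real (K * s)"
    using E(3) K s(3) by (simp add: field_simps)
  then have "card {j \<in> dense_spots g V. snd j \<subseteq> E} < K * s" by (simp only: of_nat_less_iff)
  then show thesis
    using that[of E s] E(1,2) unfolding V_def by auto
qed

text \<open>One vertex of every dense spot is deleted, so no spot survives. More than
  \<open>K * s\<close> vertices remain, hence among \<open>K\<close> colour classes one has at least
  \<open>s\<close> vertices and spans an edge.\<close>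

lemma sparse_non_colourable_graph_exists:
  assumes K: "0 < K"
  obtains F :: "nat ograph"
  where "ordered_graph F" "\<And>c. \<not> proper_colouring F K c"
    "\<And>G. subgraph G F \<Longrightarrow> verts G \<noteq> {} \<Longrightarrow> card (verts G) \<le> g \<Longrightarrow> card (edges G) < card (verts G)"
proof -
  obtain s :: nat and E :: "nat set set"
    where EV: "E \<subseteq> pairs {..<2 * K * s}"
      and indep: "\<And>S. S \<subseteq> {..<2 * K * s} \<Longrightarrow> card S = s \<Longrightarrow> pairs S \<inter> E \<noteq> {}"
      and dense: "card {j \<in> dense_spots g {..<2 * K * s}. snd j \<subseteq> E} < K * s"
    by (rule sparse_edge_set_exists[OF K, of g]) (rule that)
  define V where "V = {..<2 * K * s}"
  define J where "J = {j \<in> dense_spots g V. snd j \<subseteq> E}"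
  define D where "D = (\<lambda>j. SOME v. v \<in> fst j) ` J"
  define W where "W = V - D"
  define F where "F = OGraph W {e \<in> E. e \<subseteq> W}"
  have finW: "finite W" by (simp add: W_def V_def)
  have "finite J" by (simp add: J_def V_def finite_dense_spots)
  then have "card D \<le> card J" unfolding D_def by (rule card_image_le)
  then have "card D < K * s" using dense by (simp add: J_def V_def)
  moreover have "card V - card D \<le> card W"
    using \<open>finite J\<close> unfolding W_def by (intro diff_card_le_card_Diff) (simp add: D_def)
  ultimately have cardW: "K * s < card W" by (simp add: V_def)
  have pair: "\<exists>u v. u \<noteq> v \<and> e = {u, v}" if "e \<in> E" for e
  proof -
    have "card e = 2" using EV that by (auto simp: pairs_def)
    then show ?thesis by (auto simp: card_2_iff)
  qed
  show thesis
  proof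
    show "ordered_graph F"
      using pair finW unfolding ordered_graph_def F_def by fastforce
    show "\<not> proper_colouring F K c" for c
    proof
      assume c: "proper_colouring F K c"
      define A where "A j = {v \<in> W. c v = j}" for j
      have "W = (\<Union>j<K. A j)" using c by (auto simp: proper_colouring_def F_def A_def)
      then have "card W \<le> (\<Sum>j<K. card (A j))" by (metis card_UN_le finite_lessThan)
      then have "\<not> (\<forall>j<K. card (A j) \<le> s)"
        using cardW sum_bounded_above[of "{..<K}" "\<lambda>j. card (A j)" s] by auto
      then obtain j where "s \<le> card (A j)" by (meson linear)
      \<comment> \<open>The class is cut down to exactly \<open>s\<close> vertices to fit
        \<open>indep\<close>; an edge inside it avoids all deleted vertices and so is an edge of
        \<open>F\<close>.\<close>
      then obtain S where S: "S \<subseteq> A j" "card S = s"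
        using obtain_subset_with_card_n by metis
      then obtain e where e: "e \<in> E" "e \<subseteq> S"
        using indep[of S] by (auto simp: A_def W_def V_def pairs_def)
      then obtain u v where uv: "e = {u, v}" using pair by blast
      then have "u \<in> A j" "v \<in> A j" using e(2) S(1) by auto
      then have "u \<in> verts F" "v \<in> verts F" "{u, v} \<in> edges F" "c u = c v"
        using e(1) uv by (auto simp: F_def A_def)
      then show False using c unfolding proper_colouring_def by blast
    qed
    fix G assume G: "subgraph G F" "verts G \<noteq> {}" "card (verts G) \<le> g"
    show "card (edges G) < card (verts G)"
    proof (rule ccontr)
      assume "\<not> card (edges G) < card (verts G)"
      \<comment> \<open>Trimming to exactly \<open>card (verts G)\<close> edges gives a dense spot,
        whose chosen vertex was deleted and yet lies in \<open>G\<close>.\<close>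
      then obtain T where T: "T \<subseteq> edges G" "card T = card (verts G)"
        using obtain_subset_with_card_n by (metis not_less)
      have "edges G \<subseteq> pairs (verts G)"
        using G(1) by (fastforce simp: subgraph_def ordered_graph_def pairs_def)
      then have "(verts G, T) \<in> J"
        using G T by (auto simp: J_def dense_spots_def subgraph_def F_def W_def)
      then have "(SOME v. v \<in> fst (verts G, T)) \<in> D" unfolding D_def by (rule imageI)
      moreover have "(SOME v. v \<in> fst (verts G, T)) \<in> W"
        using G(1,2) some_in_eq[of "verts G"] by (auto simp: subgraph_def F_def)
      ultimately show False by (simp add: W_def)
    qed
  qed
qed

section \<open>Ramsey graphs from large chromatic number\<close>

lemma finite_edges: "ordered_graph G \<Longrightarrow> finite (edges G)"
  by (rule finite_subset[of _ "Pow (verts G)"]) (auto simp: ordered_graph_def)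

text \<open>The \<open>LEAST\<close> is attained, because an injective numbering of the vertices is
  a proper colouring.\<close>

lemma proper_colouring_chromatic_number:
  assumes "ordered_graph G"
  obtains c where "proper_colouring G (chromatic_number G) c"
proof -
  have "finite (verts G)" using assms by (simp add: ordered_graph_def)
  then obtain h :: "'a \<Rightarrow> nat" where h: "bij_betw h (verts G) {0..<card (verts G)}"
    using ex_bij_betw_finite_nat by blast
  have "u \<noteq> v" if "{u, v} \<in> edges G" for u v
    using assms that by (force simp: ordered_graph_def doubleton_eq_iff)
  then have "proper_colouring G (card (verts G)) h"
    using h by (auto simp: proper_colouring_def bij_betw_def inj_on_def)
  then have "\<exists>c. proper_colouring G (chromatic_number G) c"
    unfolding chromatic_number_def by (intro LeastI exI)
  then show thesis using that by blast
qed

lemma ramsey_set_if_not_colourable: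
  fixes H :: "'a::linorder ograph" and H' :: "'b::linorder ograph"
  assumes H: "\<And>F :: nat ograph. ordered_graph F \<Longrightarrow> k \<le> chromatic_number F \<Longrightarrow> \<exists>G. is_copy G H F"
    and H': "\<And>F :: nat ograph. ordered_graph F \<Longrightarrow> k' \<le> chromatic_number F \<Longrightarrow> \<exists>G. is_copy G H' F"
    and F: "ordered_graph F" and K: "k * k' \<le> K" and nc: "\<And>c. \<not> proper_colouring F K c"
  shows "F \<in> ramsey_set H H'"
proof -
  have "(\<exists>G. is_copy G H F \<and> (\<forall>e\<in>edges G. c e = Red)) \<or>
      (\<exists>G. is_copy G H' F \<and> (\<forall>e\<in>edges G. c e = Blue))" for c
  proof -
    define P where "P x = OGraph (verts F) {e \<in> edges F. c e = x}" for x
    have P: "ordered_graph (P x)" for x using F by (auto simp: ordered_graph_def P_def)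
    \<comment> \<open>A copy inside the colour class \<open>P x\<close> is a monochromatic copy in
      \<open>F\<close>.\<close>
    have copy: "is_copy G L F \<and> (\<forall>e\<in>edges G. c e = x)" if "is_copy G L (P x)"
      for G x and L :: "'c::linorder ograph"
      using that by (auto simp: is_copy_def subgraph_def P_def)
    have "k \<le> chromatic_number (P Red) \<or> k' \<le> chromatic_number (P Blue)"
    proof (rule ccontr)
      assume "\<not> ?thesis"
      then have less: "chromatic_number (P Red) < k" "chromatic_number (P Blue) < k'" by auto
      obtain r b where r: "proper_colouring (P Red) (chromatic_number (P Red)) r"
        and b: "proper_colouring (P Blue) (chromatic_number (P Blue)) b"
        using proper_colouring_chromatic_number[OF P] by metis
      have bound: "r v < k" "b v < k'" if "v \<in> verts F" for v
        using r b less that by (fastforce simp: proper_colouring_def P_def)+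
      \<comment> \<open>The pair \<open>(r v, b v)\<close> is encoded as one number below
        \<open>k * k'\<close>; since \<open>b v < k'\<close>, division by \<open>k'\<close> recovers
        \<open>r v\<close>.\<close>
      have "proper_colouring F K (\<lambda>v. r v * k' + b v)"
        unfolding proper_colouring_def
      proof (intro conjI ballI impI)
        fix v assume v: "v \<in> verts F"
        have "r v * k' + b v < Suc (r v) * k'" using bound[OF v] by simp
        also have "\<dots> \<le> k * k'" using bound[OF v] by (intro mult_right_mono) auto
        finally show "r v * k' + b v < K" using K by simp
      next
        fix u v assume uv: "u \<in> verts F" "v \<in> verts F" "{u, v} \<in> edges F"
        show "r u * k' + b u \<noteq> r v * k' + b v"
        proof
          assume eq: "r u * k' + b u = r v * k' + b v"
          have "r u = r v"
            using arg_cong[OF eq, of "\<lambda>x. x div k'"] bound(2)[OF uv(1)] bound(2)[OF uv(2)] by simp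
          moreover from this have "b u = b v" using eq by simp
          moreover have "c {u, v} = Red \<or> c {u, v} = Blue" using colour.exhaust by blast
          ultimately show False
            using r b uv by (auto simp: proper_colouring_def P_def)
        qed
      qed
      then show False using nc by blast
    qed
    then show ?thesis using H[OF P] H'[OF P] copy by metis
  qed
  then show ?thesis using F by (simp add: ramsey_set_def)
qed

section \<open>Minimal Ramsey graphs\<close>

text \<open>Choose a Ramsey subgraph minimising vertices plus edges: a proper subgraph loses at
  least one of either kind, so the sum strictly drops.\<close>

lemma minimal_ramsey_subgraph:
  assumes "F \<in> ramsey_set H H'"
  obtains M where "M \<in> minimal_ramsey_set H H'" "subgraph M F"
proof -
  have "subgraph F F" using assms by (simp add: subgraph_def ramsey_set_def)
  then obtain M where M: "M \<in> ramsey_set H H'" "subgraph M F"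
    and least: "\<And>G. G \<in> ramsey_set H H' \<Longrightarrow> subgraph G F \<Longrightarrow>
      card (verts M) + card (edges M) \<le> card (verts G) + card (edges G)"
    using assms ex_has_least_nat[of "\<lambda>G. G \<in> ramsey_set H H' \<and> subgraph G F" F
        "\<lambda>G. card (verts G) + card (edges G)"] by blast
  have "G \<notin> ramsey_set H H'" if G: "subgraph G M" "G \<noteq> M" for G
  proof
    assume "G \<in> ramsey_set H H'"
    moreover have "subgraph G F" using G(1) M(2) by (auto simp: subgraph_def)
    ultimately have le: "card (verts M) + card (edges M) \<le> card (verts G) + card (edges G)"
      by (rule least)
    have sub: "verts G \<subseteq> verts M" "edges G \<subseteq> edges M" using G(1) by (auto simp: subgraph_def)
    have fin: "finite (verts M)" "finite (edges M)"
      using M(2) finite_edges by (auto simp: subgraph_def ordered_graph_def)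
    have "card (verts G) \<le> card (verts M)" "card (edges G) \<le> card (edges M)"
      using sub fin by (auto intro: card_mono)
    then have "card (verts G) = card (verts M)" "card (edges G) = card (edges M)"
      using le by auto
    then have "verts G = verts M" "edges G = edges M"
      using sub fin card_subset_eq by blast+
    then show False using G(2) by (simp add: ograph.expand)
  qed
  then show thesis using that[of M] M by (auto simp: minimal_ramsey_set_def)
qed

text \<open>A finite graph has finitely many subgraphs, itself among them, so \<open>Max\<close>
  ranges over a finite nonempty set.\<close>

lemma density_attained:
  assumes "ordered_graph F"
  shows "density F \<in> {real (card (edges G)) / real (card (verts G)) | G. subgraph G F}"
  unfolding density_def
proof (rule Max_in)
  have "{G. subgraph G F} \<subseteq> (\<lambda>(V, E). OGraph V E) ` (Pow (verts F) \<times> Pow (edges F))"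
  proof
    fix G assume "G \<in> {G. subgraph G F}"
    then have "G = (\<lambda>(V, E). OGraph V E) (verts G, edges G)"
      "(verts G, edges G) \<in> Pow (verts F) \<times> Pow (edges F)" by (auto simp: subgraph_def)
    then show "G \<in> (\<lambda>(V, E). OGraph V E) ` (Pow (verts F) \<times> Pow (edges F))" by blast
  qed
  then have "finite {G. subgraph G F}"
    by (rule finite_subset) (use assms finite_edges in \<open>auto simp: ordered_graph_def\<close>)
  then show "finite {real (card (edges G)) / real (card (verts G)) | G. subgraph G F}"
    by (simp add: setcompr_eq_image)
  show "{real (card (edges G)) / real (card (verts G)) | G. subgraph G F} \<noteq> {}"
    using assms by (auto simp: subgraph_def)
qed

text \<open>Densities are nonnegative, which gives the lower bound that a real \<open>Inf\<close>
  requires.\<close>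

lemma ramsey_density_le:
  assumes "F \<in> ramsey_set H H'" shows "ramsey_density H H' \<le> density F"
  unfolding ramsey_density_def
proof (rule cInf_lower)
  have "0 \<le> density G" if "G \<in> ramsey_set H H'" for G
    using density_attained[of G] that by (auto simp: ramsey_set_def)
  then show "bdd_below (density ` ramsey_set H H')" by (rule bdd_belowI2)
qed (use assms in simp)

section \<open>Isomorphism classes and vertex counts\<close>

lemma order_iso_card_verts: "order_iso F G \<Longrightarrow> card (verts F) = card (verts G)"
  by (auto simp: order_iso_def bij_betw_same_card)

lemma order_iso_refl: "order_iso F F"
  unfolding order_iso_def by (rule exI[of _ id]) (auto simp: strict_mono_on_def)

text \<open>The vertex count is an isomorphism invariant, so it can be read off from any
  representative of a class, and finitely many classes yield finitely many counts.\<close>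

lemma ramsey_finite_card_verts:
  assumes "ramsey_finite H H'"
  shows "finite ((\<lambda>F. card (verts F)) ` minimal_ramsey_set H H')"
proof -
  let ?M = "minimal_ramsey_set H H'"
  define R where "R = {(F, G). F \<in> ?M \<and> G \<in> ?M \<and> order_iso F G}"
  have "(\<lambda>F. card (verts F)) ` ?M \<subseteq> (\<lambda>C. card (verts (SOME F. F \<in> C))) ` (?M // R)"
  proof
    fix n assume "n \<in> (\<lambda>F. card (verts F)) ` ?M"
    then obtain F where F: "F \<in> ?M" "n = card (verts F)" by blast
    then have "F \<in> R `` {F}" by (simp add: R_def order_iso_refl)
    then have "(SOME G. G \<in> R `` {F}) \<in> R `` {F}" by (rule someI)
    then have "(F, SOME G. G \<in> R `` {F}) \<in> R" by (simp only: Image_singleton_iff)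
    then have "order_iso F (SOME G. G \<in> R `` {F})" by (simp only: R_def mem_Collect_eq case_prod_conv)
    then have "n = card (verts (SOME G. G \<in> R `` {F}))" using F(2) order_iso_card_verts by simp
    moreover have "R `` {F} \<in> ?M // R" using F(1) by (rule quotientI)
    ultimately show "n \<in> (\<lambda>C. card (verts (SOME F. F \<in> C))) ` (?M // R)" by blast
  qed
  then show ?thesis
    by (rule finite_subset) (use assms in \<open>simp add: ramsey_finite_def R_def\<close>)
qed

theorem theorem12:
  fixes H :: "'a::linorder ograph" and H' :: "'b::linorder ograph"
  assumes "ordered_graph H" and "ordered_graph H'"
    and "chi_unavoidable H" and "chi_unavoidable H'"
    and "ramsey_density H H' \<ge> 1"
  shows "ramsey_infinite H H'"
proof -
  obtain k k' where
    k: "\<And>F :: nat ograph. ordered_graph F \<Longrightarrow> k \<le> chromatic_number F \<Longrightarrow> \<exists>G. is_copy G H F" and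
    k': "\<And>F :: nat ograph. ordered_graph F \<Longrightarrow> k' \<le> chromatic_number F \<Longrightarrow> \<exists>G. is_copy G H' F"
    using assms(3,4) unfolding chi_unavoidable_def by blast
  have large: "\<exists>M \<in> minimal_ramsey_set H H'. g < card (verts M)" for g
  proof -
    \<comment> \<open>\<open>Suc\<close> makes the number of colours positive even if
      \<open>k * k' = 0\<close>.\<close>
    obtain F :: "nat ograph" where F: "ordered_graph F" "\<And>c. \<not> proper_colouring F (Suc (k * k')) c"
      and sparse: "\<And>G. subgraph G F \<Longrightarrow> verts G \<noteq> {} \<Longrightarrow> card (verts G) \<le> g \<Longrightarrow>
        card (edges G) < card (verts G)"
      using sparse_non_colourable_graph_exists[of "Suc (k * k')" g] by blast
    have "F \<in> ramsey_set H H'"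
      by (rule ramsey_set_if_not_colourable[OF k k' F(1) _ F(2)]) auto
    then obtain M where M: "M \<in> minimal_ramsey_set H H'" "subgraph M F"
      by (rule minimal_ramsey_subgraph)
    then have "1 \<le> density M"
      using assms(5) ramsey_density_le[of M H H'] by (simp add: minimal_ramsey_set_def)
    then obtain G where G: "subgraph G M" "1 \<le> real (card (edges G)) / real (card (verts G))"
      using density_attained[of M] M(2) by (auto simp: subgraph_def)
    \<comment> \<open>Division by zero yields 0, so a quotient of at least 1 rules out the graph
      without vertices.\<close>
    have "card (verts G) \<noteq> 0"
    proof
      assume "card (verts G) = 0"
      then show False using G(2) by simp
    qed
    then have "verts G \<noteq> {}" "card (verts G) \<le> card (edges G)"
      using G(2) by (auto simp: le_divide_eq)
    moreover have "subgraph G F" using G(1) M(2) by (auto simp: subgraph_def)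
    ultimately have "g < card (verts G)" using sparse[of G] by linarith
    also have "\<dots> \<le> card (verts M)"
      using G(1) M(2) by (intro card_mono) (auto simp: subgraph_def ordered_graph_def)
    finally show ?thesis using M(1) by blast
  qed
  show ?thesis
    unfolding ramsey_infinite_def
  proof
    assume "ramsey_finite H H'"
    then obtain g where "\<And>M. M \<in> minimal_ramsey_set H H' \<Longrightarrow> card (verts M) \<le> g"
      using ramsey_finite_card_verts finite_nat_set_iff_bounded_le by (metis imageI)
    then show False using large[of g] by (meson not_less)
  qed
qed

end
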